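(* Let $n\ge 1$ be an integer, let $k\in\mathbb{Z}$, let $a=\frac{k\pi}{2}$ and $b=\frac{(k+1)\pi}{2}$, and let $q>0$ be real. Then the sequence $\{B^{n}_{0}(x;q),B^{n}_{1}(x;q),\ldots,B^{n}_{n}(x;q)\}$ of quantum trigonometric Bernstein basis functions of degree $n$ over the interval $[a,b]$ is totally positive on $\left[\frac{k\pi}{2},\frac{(k+1)\pi}{2}\right]$.
   Context: For real $x,y,q$ put $d(x,y;q):=\frac{q+1}{2}\sin(y-x)+\frac{q-1}{2}\sin(y+x)$. The $q$-integers are $[m]_q=\frac{1-q^m}{1-q}$ if $q\ne 1$ and $[m]_1=m$; the $q$-factorials are $[m]_q!=[m]_q[m-1]_q\cdots[1]_q$ for $m\ge 1$ and $[0]_q!=1$; the $q$-binomial coefficients are ${n\brack i}_q=\frac{[n]_q!}{[i]_q!\,[n-i]_q!}$ for $0\le i\le n$. For an interval $[a,b]$ with $d(a,b;q^j)\neq 0$ for $j=0,1,\ldots,n$ (this holds automatically for the interval and $q$ in the claim), the quantum trigonometric Bernstein basis functions of degree $n$ over $[a,b]$ are $$B^{n}_{i}(x;q)={n\brack i}_{q}\,\frac{\prod_{j=0}^{i-1}d(a,x;q^{j})\cdot\prod_{j=0}^{n-i-1}d(x,b;q^{j})}{\prod_{j=0}^{n-1}d(a,b;q^{j})},\qquad i=0,1,\ldots,n,$$ with empty products equal to $1$. A sequence of real-valued functions $\{\phi_0,\ldots,\phi_n\}$ is totally positive on an interval $I$ if for every $m\ge 0$ and all points $x_0<x_1<\cdots<x_m$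 in $I$ the collocation matrix $(\phi_i(x_j))_{0\le i\le n,\,0\le j\le m}$ is totally positive, i.e. all of its minors are nonnegative. *)

theory Defs
  imports
    Complex_Main
    "Jordan_Normal_Form.Determinant"
    "Jordan_Normal_Form.DL_Submatrix"
begin

definition qtrig_d :: "real \<Rightarrow> real \<Rightarrow> real \<Rightarrow> real" where
  "qtrig_d x y q = (q + 1) / 2 * sin (y - x) + (q - 1) / 2 * sin (y + x)"

definition q_int :: "real \<Rightarrow> nat \<Rightarrow> real" where
  "q_int q m = (if q = 1 then real m else (1 - q ^ m) / (1 - q))"

definition q_fact :: "real \<Rightarrow> nat \<Rightarrow> real" where
  "q_fact q m = (\<Prod>j = 1..m. q_int q j)"

(* Meant for i \<le> n only. *)
definition q_binom :: "real \<Rightarrow> nat \<Rightarrow> nat \<Rightarrow> real" where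
  "q_binom q n i = q_fact q n / (q_fact q i * q_fact q (n - i))"

(* qtrig_bernstein a b q n i x is the basis function B^n_i(x;q) over [a,b]. It is meant for
   i \<le> n and qtrig_d a b (q ^ j) \<noteq> 0 for j = 0, ..., n. *)
definition qtrig_bernstein ::
  "real \<Rightarrow> real \<Rightarrow> real \<Rightarrow> nat \<Rightarrow> nat \<Rightarrow> real \<Rightarrow> real" where
  "qtrig_bernstein a b q n i x =
     q_binom q n i *
     ((\<Prod>j<i. qtrig_d a x (q ^ j)) * (\<Prod>j<n - i. qtrig_d x b (q ^ j))) /
     (\<Prod>j<n. qtrig_d a b (q ^ j))"

(* All minors are nonnegative. Rows and columns of a submatrix keep their order; for
   I = J = {} the minor is the determinant 1 of the empty matrix. *)
definition totally_positive_mat :: "real mat \<Rightarrow> bool" where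
  "totally_positive_mat A \<longleftrightarrow>
     (\<forall>I J. I \<subseteq> {..<dim_row A} \<longrightarrow> J \<subseteq> {..<dim_col A} \<longrightarrow> card I = card J \<longrightarrow>
        det (submatrix A I J) \<ge> 0)"

definition collocation_mat ::
  "nat \<Rightarrow> (nat \<Rightarrow> real \<Rightarrow> real) \<Rightarrow> nat \<Rightarrow> (nat \<Rightarrow> real) \<Rightarrow> real mat" where
  "collocation_mat n \<phi> m x = mat (n + 1) (m + 1) (\<lambda>(i, j). \<phi> i (x j))"

(* Total positivity of the sequence \<phi> 0, ..., \<phi> n on S; the values \<phi> i for i > n are ignored. *)
definition totally_positive_on ::
  "real set \<Rightarrow> nat \<Rightarrow> (nat \<Rightarrow> real \<Rightarrow> real) \<Rightarrow> bool" where
  "totally_positive_on S n \<phi> \<longleftrightarrow>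
     (\<forall>m x. strict_mono_on {0..m} x \<longrightarrow> x ` {0..m} \<subseteq> S \<longrightarrow>
        totally_positive_mat (collocation_mat n \<phi> m x))"

end

theory Submission
  imports Defs
begin

text \<open>
  Since \<open>sin a * cos a = 0\<close>, every factor of \<open>B\<^sub>i\<close> is a positive constant times
  \<open>sin (x - a)\<close> or \<open>cos (x - a)\<close>, so that \<open>B\<^sub>i(x) = c\<^sub>i sin\<^sup>i(x - a) cos\<^sup>n\<^sup>-\<^sup>i(x - a)\<close> with
  \<open>c\<^sub>i > 0\<close>. In the open interval this is \<open>c\<^sub>i cos\<^sup>n(x - a) exp (i * ln (tan (x - a)))\<close>, and the
  minors are positive because the kernel \<open>exp (x * y)\<close> is strictly totally positive; the closed
  interval follows by continuity. For the kernel, induct on the order: make the first row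
  constant by scaling columns, subtract neighbouring columns, and replace the differences
  column by column by derivatives, using the mean value theorem.
\<close>

section \<open>Determinants\<close>

lemma det_mat_permutes:
  "det (mat n n f) = (\<Sum>p | p permutes {0..<n}. signof p * (\<Prod>i = 0..<n. f (i, p i)))"
  by (subst det_def') (auto intro!: sum.cong prod.cong simp: permutes_in_image)

text \<open>Each term of the Leibniz sum takes one entry from every row and every column, so all
  terms share the same product of scaling factors.\<close>

lemma det_mat_scale:
  fixes f :: "nat \<Rightarrow> nat \<Rightarrow> 'a :: comm_ring_1"
  shows "det (mat n n (\<lambda>(i, j). u i * v j * f i j)) =
    (\<Prod>i = 0..<n. u i) * (\<Prod>j = 0..<n. v j) * det (mat n n (\<lambda>(i, j). f i j))"
proof -
  have "(\<Prod>i = 0..<n. u i * v (p i) * f i (p i)) =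
      (\<Prod>i = 0..<n. u i) * (\<Prod>j = 0..<n. v j) * (\<Prod>i = 0..<n. f i (p i))"
    if "p permutes {0..<n}" for p
    using prod.permute[OF that, of v] by (simp add: prod.distrib o_def)
  then show ?thesis
    unfolding det_mat_permutes sum_distrib_left by (intro sum.cong) (auto simp: algebra_simps)
qed

text \<open>Laplace expansion along column \<open>l\<close>: the cofactors do not involve that
  column, so one choice of \<open>c\<close> serves all \<open>v\<close>.\<close>

lemma det_mat_column_linear:
  fixes f :: "nat \<times> nat \<Rightarrow> 'a :: comm_ring_1"
  assumes "l < n"
  obtains c where
    "\<And>v. det (mat n n (\<lambda>(i, j). if j = l then v i else f (i, j))) = (\<Sum>i<n. v i * c i)"
proof
  fix v :: "nat \<Rightarrow> 'a"
  let ?M = "\<lambda>v. mat n n (\<lambda>(i, j). if j = l then v i else f (i, j))"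
  have "mat_delete (?M v) i l = mat_delete (?M (\<lambda>_. 0)) i l" if "i < n" for i
    by (intro eq_matI) (auto simp: mat_delete_def)
  then have "cofactor (?M v) i l = cofactor (?M (\<lambda>_. 0)) i l" if "i < n" for i
    using that by (simp add: cofactor_def)
  then show "det (?M v) = (\<Sum>i<n. v i * cofactor (?M (\<lambda>_. 0)) i l)"
    using assms by (subst laplace_expansion_column[of _ n l]) auto
qed

text \<open>Right multiplication by the unit bidiagonal matrix \<open>U\<close> subtracts from each
  column its left neighbour. The first row becomes (1, 0, ..., 0), and the block structure gives the
  rest.\<close>

lemma det_first_row_ones:
  fixes f :: "nat \<times> nat \<Rightarrow> 'a :: idom"
  assumes "\<And>j. j \<le> n \<Longrightarrow> f (0, j) = 1"
  shows "det (mat (Suc n) (Suc n) f) =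
    det (mat n n (\<lambda>(i, j). f (Suc i, Suc j) - f (Suc i, j)))"
proof -
  define U :: "'a mat" where
    "U = mat (Suc n) (Suc n) (\<lambda>(i, j). if i = j then 1 else if Suc i = j then - 1 else 0)"
  let ?M = "mat (Suc n) (Suc n) f"
  let ?N = "mat n n (\<lambda>(i, j). f (Suc i, Suc j) - f (Suc i, j))"
  have "upper_triangular U" "diag_mat U = replicate (Suc n) 1"
    by (auto simp: U_def diag_mat_def simp del: upt_Suc replicate_Suc intro!: nth_equalityI)
  then have "det U = 1"
    by (subst det_upper_triangular[of _ "Suc n"]) (auto simp: U_def)
  then have "det ?M = det (?M * U)"
    by (subst det_mult[of _ "Suc n"]) (auto simp: U_def)
  also have "?M * U =
      four_block_mat (mat 1 1 (\<lambda>_. 1)) (0\<^sub>m 1 n) (mat n 1 (\<lambda>(i, _). f (Suc i, 0))) ?N"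
    (is "_ = ?B")
  proof (rule eq_matI)
    fix i j assume "i < dim_row ?B" "j < dim_col ?B"
    then have ij: "i \<le> n" "j \<le> n" by auto
    have "(?M * U) $$ (i, j) = (\<Sum>k<Suc n. f (i, k) * U $$ (k, j))"
      using ij by (simp add: U_def scalar_prod_def atLeast0LessThan del: sum.lessThan_Suc)
    also have "\<dots> = (\<Sum>k<Suc n. (if k = j then f (i, j) else 0) -
        (if j \<noteq> 0 \<and> k = j - 1 then f (i, k) else 0))"
      using ij by (intro sum.cong) (auto simp: U_def)
    also have "\<dots> = f (i, j) - (if j = 0 then 0 else f (i, j - 1))"
      using ij by (simp add: sum_subtractf less_Suc_eq_le del: sum.lessThan_Suc)
    also have "\<dots> = ?B $$ (i, j)"
      using ij assms by (cases i; cases j) auto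
    finally show "(?M * U) $$ (i, j) = ?B $$ (i, j)" .
  qed (auto simp: U_def)
  also have "det \<dots> = det (mat 1 1 (\<lambda>_. 1 :: 'a)) * det ?N"
    by (rule det_four_block_mat_upper_right_zero[of _ 1 _ n]) auto
  also have "det (mat 1 1 (\<lambda>_. 1 :: 'a)) = 1"
    by (simp add: det_single)
  finally show ?thesis by simp
qed

text \<open>The intermediate point found for one column depends on the points chosen for the others.
  Hence \<open>pos\<close> is required for every choice of one point in each gap.\<close>

lemma det_differences_pos:
  fixes F F' :: "nat \<Rightarrow> real \<Rightarrow> real" and y :: "nat \<Rightarrow> real"
  assumes deriv: "\<And>i t. i < n \<Longrightarrow> (F i has_real_derivative F' i t) (at t)"
    and y: "\<And>j. j < n \<Longrightarrow> y j < y (Suc j)"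
    and pos: "\<And>s. (\<And>j. j < n \<Longrightarrow> y j < s j \<and> s j < y (Suc j)) \<Longrightarrow>
      det (mat n n (\<lambda>(i, j). F' i (s j))) > 0"
  shows "det (mat n n (\<lambda>(i, j). F i (y (Suc j)) - F i (y j))) > 0"
proof -
  \<comment> \<open>\<open>A l s\<close> has derivative columns before position \<open>l\<close> and
    difference columns from there on. It runs from the goal at \<open>l = 0\<close> to
    \<open>pos\<close> at \<open>l = n\<close>; the induction descends from
    \<open>n\<close>.\<close>
  define A where "A l s = mat n n (\<lambda>(i, j).
      if j < l then F' i (s j) else F i (y (Suc j)) - F i (y j))" for l :: nat and s
  have "det (A l s) > 0" if "l \<le> n" "\<And>j. j < l \<Longrightarrow> y j < s j \<and> s j < y (Suc j)" for l s
    using that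
  proof (induction arbitrary: s rule: inc_induct)
    case base
    have "A n s = mat n n (\<lambda>(i, j). F' i (s j))"
      by (auto simp: A_def)
    then show ?case using pos base by simp
  next
    case (step l)
    \<comment> \<open>\<open>A l s\<close> and \<open>A (Suc l) (s(l := \<xi>))\<close> differ only
      in column \<open>l\<close>, so the same \<open>c\<close> computes both determinants. The first
      is an increment of \<open>g\<close>, the second a value of its derivative.\<close>
    obtain c where c: "\<And>v. det (mat n n (\<lambda>(i, j). if j = l then v i else A l s $$ (i, j))) =
        (\<Sum>i<n. v i * c i)"
      using det_mat_column_linear[OF step.hyps(2), of "\<lambda>p. A l s $$ p"] by blast
    define g where "g t = (\<Sum>i<n. F i t * c i)" for t
    have g: "(g has_real_derivative (\<Sum>i<n. F' i t * c i)) (at t)" for t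
      unfolding g_def by (intro DERIV_sum DERIV_cmult_right deriv) auto
    obtain \<xi> where \<xi>: "y l < \<xi>" "\<xi> < y (Suc l)"
        "g (y (Suc l)) - g (y l) = (y (Suc l) - y l) * (\<Sum>i<n. F' i \<xi> * c i)"
      using MVT2[OF y[OF step.hyps(2)], of g, OF g] by blast
    have "A (Suc l) (s(l := \<xi>)) =
        mat n n (\<lambda>(i, j). if j = l then F' i \<xi> else A l s $$ (i, j))"
      by (auto simp: A_def less_Suc_eq)
    moreover have "det (A (Suc l) (s(l := \<xi>))) > 0"
      using step.prems \<xi> by (intro step.IH) (auto simp: less_Suc_eq)
    ultimately have "(\<Sum>i<n. F' i \<xi> * c i) > 0"
      by (simp add: c)
    then have "g (y (Suc l)) - g (y l) > 0"
      using \<xi> by simp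
    moreover have "A l s =
        mat n n (\<lambda>(i, j). if j = l then F i (y (Suc l)) - F i (y l) else A l s $$ (i, j))"
      by (auto simp: A_def)
    then have "det (A l s) = g (y (Suc l)) - g (y l)"
      unfolding g_def sum_subtractf[symmetric] left_diff_distrib[symmetric]
      using c[of "\<lambda>i. F i (y (Suc l)) - F i (y l)"] by simp
    ultimately show ?case by simp
  qed
  from this[of 0] show ?thesis
    by (simp add: A_def)
qed

section \<open>The exponential kernel\<close>

lemma det_exp_kernel_pos:
  fixes x y :: "nat \<Rightarrow> real"
  assumes "strict_mono_on {..<n} x" "strict_mono_on {..<n} y"
  shows "det (mat n n (\<lambda>(i, j). exp (x i * y j))) > 0"
  using assms
proof (induction n arbitrary: x y)
  case 0
  show ?case by simp
next
  case (Suc n)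
  \<comment> \<open>Shifting the exponents by \<open>x 0\<close> takes a positive factor out of each
    column and makes row 0 constant 1. The other \<open>z\<close> stay positive, so differentiation
    in \<open>y\<close> yields positive row factors.\<close>
  define z where "z i = x i - x 0" for i
  have z_pos: "z (Suc i) > 0" if "i < n" for i
    using that Suc.prems(1) by (auto simp: z_def strict_mono_on_def)
  have z_mono: "strict_mono_on {..<n} (\<lambda>i. z (Suc i))"
    using Suc.prems(1) by (auto simp: z_def strict_mono_on_def)
  have y_mono: "y i < y j" if "i < j" "j \<le> n" for i j
    using that Suc.prems(2) by (auto simp: strict_mono_on_def)
  have "(\<lambda>(i, j). exp (x i * y j)) = (\<lambda>(i, j). 1 * exp (x 0 * y j) * exp (z i * y j))"
    by (auto simp: z_def fun_eq_iff algebra_simps simp flip: exp_add)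
  then have "det (mat (Suc n) (Suc n) (\<lambda>(i, j). exp (x i * y j))) =
      (\<Prod>j = 0..<Suc n. exp (x 0 * y j)) *
        det (mat (Suc n) (Suc n) (\<lambda>(i, j). exp (z i * y j)))"
    using det_mat_scale[of "Suc n" "\<lambda>_. 1" "\<lambda>j. exp (x 0 * y j)" "\<lambda>i j. exp (z i * y j)"]
    by (simp only: prod.neutral_const mult_1)
  also have "det (mat (Suc n) (Suc n) (\<lambda>(i, j). exp (z i * y j))) =
      det (mat n n (\<lambda>(i, j). exp (z (Suc i) * y (Suc j)) - exp (z (Suc i) * y j)))"
    by (subst det_first_row_ones) (auto simp: z_def)
  finally have eq: "det (mat (Suc n) (Suc n) (\<lambda>(i, j). exp (x i * y j))) =
      (\<Prod>j = 0..<Suc n. exp (x 0 * y j)) *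
        det (mat n n (\<lambda>(i, j). exp (z (Suc i) * y (Suc j)) - exp (z (Suc i) * y j)))" .
  have "det (mat n n (\<lambda>(i, j). exp (z (Suc i) * y (Suc j)) - exp (z (Suc i) * y j))) > 0"
  proof (rule det_differences_pos[where F' = "\<lambda>i t. z (Suc i) * exp (z (Suc i) * t)"])
    fix s assume s: "\<And>j. j < n \<Longrightarrow> y j < s j \<and> s j < y (Suc j)"
    \<comment> \<open>Points from successive gaps are increasing, so the induction hypothesis
      applies to them.\<close>
    have "s i < s j" if "i < j" "j < n" for i j
    proof -
      have "s i < y (Suc i)" "y (Suc i) \<le> y j" "y j < s j"
        using s[of i] s[of j] that y_mono[of "Suc i" j] by (cases "Suc i = j"; force)+
      then show ?thesis by linarith
    qed
    then have "det (mat n n (\<lambda>(i, j). exp (z (Suc i) * s j))) > 0"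
      using z_mono by (intro Suc.IH) (auto simp: strict_mono_on_def)
    moreover have "(\<Prod>i = 0..<n. z (Suc i)) > 0"
      using z_pos by (intro prod_pos) auto
    ultimately show "det (mat n n (\<lambda>(i, j). z (Suc i) * exp (z (Suc i) * s j))) > 0"
      using det_mat_scale[of n "\<lambda>i. z (Suc i)" "\<lambda>_. 1" "\<lambda>i j. exp (z (Suc i) * s j)"] by simp
  qed (auto intro!: derivative_eq_intros y_mono)
  then show ?case
    unfolding eq by (intro mult_pos_pos prod_pos) auto
qed

section \<open>Trigonometric monomials\<close>

lemma det_sin_cos_nonneg:
  fixes u :: "nat \<Rightarrow> real" and e :: "nat \<Rightarrow> nat"
  assumes e: "strict_mono_on {..<r} e" "\<And>i. i < r \<Longrightarrow> e i \<le> n"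
    and u: "strict_mono_on {..<r} u" "\<And>j. j < r \<Longrightarrow> 0 \<le> u j \<and> u j \<le> pi / 2"
  shows "det (mat r r (\<lambda>(i, j). sin (u j) ^ e i * cos (u j) ^ (n - e i))) \<ge> 0"
proof -
  have interior: "det (mat r r (\<lambda>(i, j). sin (w j) ^ e i * cos (w j) ^ (n - e i))) > 0"
    if w: "strict_mono_on {..<r} w" "\<And>j. j < r \<Longrightarrow> 0 < w j \<and> w j < pi / 2" for w :: "nat \<Rightarrow> real"
  proof -
    have "sin (w j) ^ e i * cos (w j) ^ (n - e i) =
        cos (w j) ^ n * exp (real (e i) * ln (tan (w j)))" if "i < r" "j < r" for i j
    proof -
      have pos: "sin (w j) > 0" "cos (w j) > 0" "tan (w j) > 0"
        using w(2)[OF that(2)] by (auto intro!: sin_gt_zero cos_gt_zero tan_gt_zero)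
      have "cos (w j) ^ n = cos (w j) ^ e i * cos (w j) ^ (n - e i)"
        using e(2)[OF that(1)] by (simp flip: power_add)
      then show ?thesis
        using pos by (simp add: exp_of_nat_mult tan_def power_divide)
    qed
    then have "det (mat r r (\<lambda>(i, j). sin (w j) ^ e i * cos (w j) ^ (n - e i))) =
        det (mat r r (\<lambda>(i, j). 1 * cos (w j) ^ n *
          exp (real (e i) * ln (tan (w j)))))"
      by (intro arg_cong[where f = det] eq_matI) auto
    also have "\<dots> = (\<Prod>j = 0..<r. cos (w j) ^ n) *
        det (mat r r (\<lambda>(i, j). exp (real (e i) * ln (tan (w j)))))"
      by (subst det_mat_scale) simp
    also have "\<dots> > 0"
    proof (intro mult_pos_pos prod_pos det_exp_kernel_pos)
      show "strict_mono_on {..<r} (\<lambda>i. real (e i))"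
        using e(1) by (auto simp: strict_mono_on_def)
      show "strict_mono_on {..<r} (\<lambda>j. ln (tan (w j)))"
      proof (rule strict_mono_onI)
        fix i j assume "i \<in> {..<r}" "j \<in> {..<r}" "i < j"
        then have "0 < w i" "w i < w j" "w j < pi / 2"
          using w by (auto simp: strict_mono_on_def)
        then show "ln (tan (w i)) < ln (tan (w j))"
          using tan_gt_zero[of "w i"] tan_gt_zero[of "w j"] tan_monotone[of "w i" "w j"] by simp
      qed
    qed (use w(2) in \<open>auto intro!: zero_less_power cos_gt_zero\<close>)
    finally show ?thesis .
  qed
  \<comment> \<open>For 0 < \<open>\<epsilon>\<close> < 1 this contraction towards the midpoint pi /
    4 keeps the order and moves all points into the open interval; at \<open>\<epsilon> = 0\<close>
    it gives back \<open>u\<close>.\<close>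
  define w where "w \<epsilon> j = (1 - \<epsilon>) * u j + \<epsilon> * (pi / 4)" for \<epsilon> :: real and j
  define g where
    "g \<epsilon> = det (mat r r (\<lambda>(i, j). sin (w \<epsilon> j) ^ e i * cos (w \<epsilon> j) ^ (n - e i)))" for \<epsilon>
  have "isCont g 0"
    unfolding g_def w_def det_mat_permutes by (auto intro!: continuous_intros)
  then have "(g \<longlongrightarrow> g 0) (at_right 0)"
    unfolding isCont_def by (rule filterlim_mono) (auto intro: at_le)
  moreover have "\<forall>\<^sub>F \<epsilon> in at_right 0. 0 \<le> g \<epsilon>"
    using eventually_at_right_real[of 0 1, simplified]
  proof eventually_elim
    case (elim \<epsilon>)
    show ?case
      unfolding g_def
    proof (intro less_imp_le interior)
      show "strict_mono_on {..<r} (w \<epsilon>)"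
        using u(1) elim by (auto simp: strict_mono_on_def w_def)
      fix j assume "j < r"
      then have "(1 - \<epsilon>) * 0 \<le> (1 - \<epsilon>) * u j" "(1 - \<epsilon>) * u j \<le> (1 - \<epsilon>) * (pi / 2)"
        using u(2)[of j] elim by (auto intro!: mult_left_mono)
      moreover have "\<epsilon> * pi > 0"
        using elim by simp
      ultimately show "0 < w \<epsilon> j \<and> w \<epsilon> j < pi / 2"
        by (auto simp: w_def algebra_simps)
    qed
  qed
  ultimately have "g 0 \<ge> 0"
    by (intro tendsto_lowerbound[of g "g 0" "at_right 0"]) auto
  then show ?thesis
    by (simp add: g_def w_def)
qed

section \<open>The quantum trigonometric Bernstein basis\<close>

text \<open>In this form \<open>q\<close> sits on a single product, so if \<open>sin\<close> or
  \<open>cos\<close> vanishes at one argument, only one of the two terms survives.\<close>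

lemma qtrig_d_eq: "qtrig_d x y q = q * sin y * cos x - cos y * sin x"
  unfolding qtrig_d_def sin_diff sin_add by (simp add: field_simps)

lemma q_int_pos:
  assumes "q > 0" "m > 0"
  shows "q_int q m > 0"
proof (cases "q < 1")
  case True
  then show ?thesis
    using assms by (auto simp: q_int_def power_less_one_iff)
next
  case False
  then show ?thesis
    using assms one_less_power[of q m] by (auto simp: q_int_def intro: divide_neg_neg)
qed

lemma q_binom_pos:
  assumes "q > 0"
  shows "q_binom q n i > 0"
proof -
  have "q_fact q m > 0" for m
    unfolding q_fact_def using assms by (auto intro!: prod_pos q_int_pos)
  then show ?thesis
    by (simp add: q_binom_def)
qed

lemma qtrig_bernstein_quarter_period:
  assumes "q > 0" "sin a * cos a = 0" "b = a + pi / 2"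
  obtains c where "\<And>i. c i > 0"
    "\<And>i x. i \<le> n \<Longrightarrow> qtrig_bernstein a b q n i x = c i * (sin (x - a) ^ i * cos (x - a) ^ (n - i))"
proof -
  \<comment> \<open>One formula for both parities of k: the value is \<open>q ^ j\<close> if
    \<open>sin a = 0\<close> and 1 if \<open>cos a = 0\<close>.\<close>
  define \<alpha> where "\<alpha> j = q ^ j * (cos a)\<^sup>2 + (sin a)\<^sup>2" for j
  have \<alpha>_pos: "\<alpha> j > 0" for j
  proof (cases "cos a = 0")
    case True
    then show ?thesis using sin_cos_squared_add[of a] by (simp add: \<alpha>_def)
  next
    case False
    then show ?thesis using assms(1) by (simp add: \<alpha>_def add_pos_nonneg)
  qed
  have b: "sin b = cos a" "cos b = - sin a"
    by (auto simp: assms(3) sin_add cos_add)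
  have axis: "sin a = 0 \<and> (cos a)\<^sup>2 = 1 \<or> cos a = 0 \<and> (sin a)\<^sup>2 = 1"
    using assms(2) sin_cos_squared_add[of a] by (cases "sin a = 0") simp_all
  have left: "qtrig_d a x (q ^ j) = \<alpha> j * sin (x - a)" for x j
    using axis unfolding qtrig_d_eq \<alpha>_def sin_diff by (auto simp: algebra_simps power2_eq_square)
  have right: "qtrig_d x b (q ^ j) = \<alpha> j * cos (x - a)" for x j
    using axis unfolding qtrig_d_eq \<alpha>_def cos_diff b by (auto simp: algebra_simps power2_eq_square)
  \<comment> \<open>Here \<open>sin (b - a) = 1\<close>.\<close>
  have both: "qtrig_d a b (q ^ j) = \<alpha> j" for j
    unfolding left by (simp add: assms(3))
  let ?c = "\<lambda>i. q_binom q n i * ((\<Prod>j<i. \<alpha> j) * (\<Prod>j<n - i. \<alpha> j)) / (\<Prod>j<n. \<alpha> j)"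
  show thesis
  proof
    show "?c i > 0" for i
      using assms(1) \<alpha>_pos by (auto intro!: divide_pos_pos mult_pos_pos prod_pos q_binom_pos)
    show "qtrig_bernstein a b q n i x = ?c i * (sin (x - a) ^ i * cos (x - a) ^ (n - i))" for i x
      unfolding qtrig_bernstein_def left right both by (simp add: prod.distrib)
  qed
qed

theorem theorem2p2:
  fixes n :: nat and k :: int and a b q :: real
  assumes "n \<ge> 1"
    and "a = of_int k * pi / 2"
    and "b = (of_int k + 1) * pi / 2"
    and "q > 0"
  shows "totally_positive_on {a..b} n (qtrig_bernstein a b q n)"
  unfolding totally_positive_on_def totally_positive_mat_def
proof (intro allI impI)
  fix m :: nat and x :: "nat \<Rightarrow> real" and I J :: "nat set"
  let ?C = "collocation_mat n (qtrig_bernstein a b q n) m x"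
  assume x: "strict_mono_on {0..m} x" "x ` {0..m} \<subseteq> {a..b}"
    and "I \<subseteq> {..<dim_row ?C}" "J \<subseteq> {..<dim_col ?C}" and card: "card I = card J"
  then have I: "I \<subseteq> {..n}" and J: "J \<subseteq> {..m}"
    by (auto simp: collocation_mat_def)
  have ab: "b = a + pi / 2"
    using assms(2,3) by (simp add: field_simps)
  have "sin (2 * a) = 0"
    unfolding assms(2) by (simp add: sin_zero_iff_int2)
  then have "sin a * cos a = 0"
    by (simp add: sin_double)
  then obtain c where c: "\<And>i. c i > 0" "\<And>i x. i \<le> n \<Longrightarrow>
      qtrig_bernstein a b q n i x = c i * (sin (x - a) ^ i * cos (x - a) ^ (n - i))"
    using qtrig_bernstein_quarter_period[OF assms(4) _ ab] by metis
  define r where "r = card I"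
  \<comment> \<open>A minor selects exponents \<open>e i\<close> and points, which \<open>u\<close>
    measures from the left end \<open>a\<close>. The coefficient \<open>c (e i)\<close> depends on
    the row only and factors out; the 1 below is the trivial column factor for
    \<open>det_mat_scale\<close>.\<close>
  define e where "e = pick I"
  define u where "u j = x (pick J j) - a" for j
  have pick_I: "e i \<le> n" and pick_J: "pick J i \<le> m" if "i < r" for i
    using that I J card pick_in_set_le[of i I] pick_in_set_le[of i J] by (auto simp: r_def e_def)
  have sets: "{i. i < n + 1 \<and> i \<in> I} = I" "{j. j < m + 1 \<and> j \<in> J} = J"
    using I J by (auto simp: less_Suc_eq_le)
  have "submatrix ?C I J = mat r r (\<lambda>(i, j). c (e i) * 1 *
      (sin (u j) ^ e i * cos (u j) ^ (n - e i)))"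
    unfolding submatrix_def collocation_mat_def dim_row_mat dim_col_mat sets
    using pick_I pick_J card
    by (intro eq_matI) (auto simp: r_def e_def u_def c(2) less_Suc_eq_le)
  then have "det (submatrix ?C I J) = (\<Prod>i = 0..<r. c (e i)) *
      det (mat r r (\<lambda>(i, j). sin (u j) ^ e i * cos (u j) ^ (n - e i)))"
    using det_mat_scale[of r "\<lambda>i. c (e i)" "\<lambda>_. 1"
        "\<lambda>i j. sin (u j) ^ e i * cos (u j) ^ (n - e i)"] by simp
  also have "\<dots> \<ge> 0"
  proof (intro mult_nonneg_nonneg prod_nonneg det_sin_cos_nonneg)
    show "strict_mono_on {..<r} e"
      by (auto simp: strict_mono_on_def e_def r_def intro: pick_mono_le)
    have "pick J i < pick J j" if "i < j" "j < r" for i j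
      using that card by (auto simp: r_def intro: pick_mono_le)
    then show "strict_mono_on {..<r} u"
      using x(1) pick_J by (auto simp: strict_mono_on_def u_def)
    show "0 \<le> u j \<and> u j \<le> pi / 2" if "j < r" for j
    proof -
      have "x (pick J j) \<in> {a..b}"
        using x(2) pick_J[OF that] by (meson atLeastAtMost_iff image_subset_iff zero_le)
      then show ?thesis by (simp add: u_def ab)
    qed
  qed (use pick_I c(1) in \<open>auto intro: less_imp_le\<close>)
  finally show "det (submatrix ?C I J) \<ge> 0" .
qed

end
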